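(* Let $R$ be a commutative noetherian ring and $\mathcal X$ a subcategory of $\operatorname{mod}R$. Suppose that for every $\mathfrak p\in\operatorname{Ass}\mathcal X$ there exists $X\in\mathcal X$ such that $\operatorname{Ass}X=\{\mathfrak p\}$. Then there is a bijection between the set of weak torsion pairs in $\mathcal X$ and the set of specialization-closed subsets of $\operatorname{Ass}\mathcal X$.
   Context: $\operatorname{mod} R$ is the category of finitely generated $R$-modules. All subcategories are full and closed under isomorphisms. $\operatorname{Ass}\mathcal X=\bigcup_{M\in\mathcal X}\operatorname{Ass}M\subseteq\operatorname{Spec}R$, with the subspace topology induced by the Zariski topology; a subset $Z$ of a topological space $Y$ is specialization-closed if the closure of $\{z\}$ in $Y$ is contained in $Z$ for every $z\in Z$. A pair $(\mathcal T,\mathcal F)$ of subcategories of $\mathcal X$ is a weak torsion pair in $\mathcal X$ if $\mathcal T=\{X\in\mathcal X\mid\operatorname{Hom}_R(X,F)=0\ \forall F\in\mathcal F\}$ and $\mathcal F=\{X\in\mathcal X\mid\operatorname{Hom}_R(T,X)=0\ \forall T\in\mathcal T\}$. *)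

theory Defs
  imports
    "HOL-Algebra.Module"
    "HOL-Algebra.Ring_Divisibility"
    "HOL-Analysis.Abstract_Topology"
begin

section \<open>Finitely generated modules and their homomorphisms\<close>

text \<open>The underlying groups of all modules live in one carrier type \<open>'m\<close>, which serves as the
  universe. The lemma \<open>fg_module_iso_universe\<close> below shows that over
  \<open>'m = (nat \<Rightarrow> 'a) set\<close> every finitely generated \<open>R\<close>-module has an isomorphic copy, so that for
  this choice of \<open>'m\<close> the isomorphism-closed sets of modules are exactly the isomorphism-closed
  subcategories of \<open>mod R\<close>. Note that a module record has unused fields \<open>mult\<close> and \<open>one\<close>, and
  operations that are unconstrained outside the carrier; records differing only in these are
  isomorphic.\<close>

definition fin_gen :: "('a, 'r) ring_scheme \<Rightarrow> ('a, 'm) module \<Rightarrow> bool" where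
  "fin_gen R M \<longleftrightarrow> (\<exists>A. finite A \<and> A \<subseteq> carrier M \<and>
     (\<forall>x\<in>carrier M. \<exists>c\<in>A \<rightarrow> carrier R. x = (\<Oplus>\<^bsub>M\<^esub>a\<in>A. c a \<odot>\<^bsub>M\<^esub> a)))"

definition fg_modules :: "('a, 'r) ring_scheme \<Rightarrow> ('a, 'm) module set" where
  "fg_modules R = {M. Module.module R M \<and> fin_gen R M}"

definition module_hom ::
  "('a, 'r) ring_scheme \<Rightarrow> ('a, 'm) module \<Rightarrow> ('a, 'n) module \<Rightarrow> ('m \<Rightarrow> 'n) set" where
  "module_hom R M N = {f \<in> carrier M \<rightarrow> carrier N.
     (\<forall>x\<in>carrier M. \<forall>y\<in>carrier M. f (x \<oplus>\<^bsub>M\<^esub> y) = f x \<oplus>\<^bsub>N\<^esub> f y) \<and>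
     (\<forall>r\<in>carrier R. \<forall>x\<in>carrier M. f (r \<odot>\<^bsub>M\<^esub> x) = r \<odot>\<^bsub>N\<^esub> f x)}"

text \<open>Elements of \<open>module_hom\<close> are arbitrary outside the carrier, so \<open>Hom(M, N) = 0\<close> has to be read
  on the carrier.\<close>

definition hom_zero :: "('a, 'r) ring_scheme \<Rightarrow> ('a, 'm) module \<Rightarrow> ('a, 'n) module \<Rightarrow> bool" where
  "hom_zero R M N \<longleftrightarrow> (\<forall>f\<in>module_hom R M N. \<forall>x\<in>carrier M. f x = \<zero>\<^bsub>N\<^esub>)"

definition module_iso :: "('a, 'r) ring_scheme \<Rightarrow> ('a, 'm) module \<Rightarrow> ('a, 'n) module \<Rightarrow> bool" where
  "module_iso R M N \<longleftrightarrow> (\<exists>f\<in>module_hom R M N. bij_betw f (carrier M) (carrier N))"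

section \<open>Subcategories and weak torsion pairs\<close>

text \<open>Full subcategories are identified with their sets of objects.\<close>

definition subcategory :: "('a, 'r) ring_scheme \<Rightarrow> ('a, 'm) module set \<Rightarrow> bool" where
  "subcategory R \<X> \<longleftrightarrow> \<X> \<subseteq> fg_modules R \<and>
     (\<forall>M\<in>\<X>. \<forall>N\<in>fg_modules R. module_iso R M N \<longrightarrow> N \<in> \<X>)"

definition weak_torsion_pair ::
  "('a, 'r) ring_scheme \<Rightarrow> ('a, 'm) module set \<Rightarrow> ('a, 'm) module set \<Rightarrow> ('a, 'm) module set \<Rightarrow> bool"
  where
  "weak_torsion_pair R \<X> \<T> \<F> \<longleftrightarrow>
     subcategory R \<T> \<and> \<T> \<subseteq> \<X> \<and> subcategory R \<F> \<and> \<F> \<subseteq> \<X> \<and>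
     \<T> = {X \<in> \<X>. \<forall>F\<in>\<F>. hom_zero R X F} \<and>
     \<F> = {X \<in> \<X>. \<forall>T\<in>\<T>. hom_zero R T X}"

section \<open>Associated primes\<close>

definition ann :: "('a, 'r) ring_scheme \<Rightarrow> ('a, 'm) module \<Rightarrow> 'm \<Rightarrow> 'a set" where
  "ann R M x = {r \<in> carrier R. r \<odot>\<^bsub>M\<^esub> x = \<zero>\<^bsub>M\<^esub>}"

definition Ass :: "('a, 'r) ring_scheme \<Rightarrow> ('a, 'm) module \<Rightarrow> 'a set set" where
  "Ass R M = {P. primeideal P R \<and> (\<exists>x\<in>carrier M. P = ann R M x)}"

definition Ass_sub :: "('a, 'r) ring_scheme \<Rightarrow> ('a, 'm) module set \<Rightarrow> 'a set set" where
  "Ass_sub R \<X> = (\<Union>M\<in>\<X>. Ass R M)"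

section \<open>The Zariski topology\<close>

definition Spec :: "('a, 'r) ring_scheme \<Rightarrow> 'a set set" where
  "Spec R = {P. primeideal P R}"

definition zero_locus :: "('a, 'r) ring_scheme \<Rightarrow> 'a set \<Rightarrow> 'a set set" where
  "zero_locus R S = {P \<in> Spec R. S \<subseteq> P}"

definition zariski :: "('a, 'r) ring_scheme \<Rightarrow> 'a set topology" where
  "zariski R = topology (\<lambda>U. \<exists>S\<subseteq>carrier R. U = Spec R - zero_locus R S)"

lemma istopology_zariski:
  "istopology (\<lambda>U. \<exists>S\<subseteq>carrier R. U = Spec R - zero_locus R S)"
  unfolding istopology_def
proof (intro conjI allI impI)
  fix U V
  assume "\<exists>S\<subseteq>carrier R. U = Spec R - zero_locus R S" "\<exists>S\<subseteq>carrier R. V = Spec R - zero_locus R S"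
  then obtain S T where S: "S \<subseteq> carrier R" "U = Spec R - zero_locus R S"
    and T: "T \<subseteq> carrier R" "V = Spec R - zero_locus R T" by blast
  let ?W = "{s \<otimes>\<^bsub>R\<^esub> t | s t. s \<in> S \<and> t \<in> T}"
  have key: "?W \<subseteq> P \<longleftrightarrow> S \<subseteq> P \<or> T \<subseteq> P" if "P \<in> Spec R" for P
  proof -
    interpret primeideal P R using that by (simp add: Spec_def)
    show ?thesis
    proof
      assume W: "?W \<subseteq> P"
      show "S \<subseteq> P \<or> T \<subseteq> P"
      proof (rule ccontr)
        assume "\<not> (S \<subseteq> P \<or> T \<subseteq> P)"
        then obtain s t where "s \<in> S" "s \<notin> P" "t \<in> T" "t \<notin> P" by blast
        then show False using W I_prime[of s t] S T by blast
      qed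
    next
      assume "S \<subseteq> P \<or> T \<subseteq> P"
      then show "?W \<subseteq> P"
        using S(1) T(1) I_l_closed I_r_closed by blast
    qed
  qed
  have mem: "P \<in> zero_locus R ?W \<longleftrightarrow> P \<in> zero_locus R S \<union> zero_locus R T" for P
  proof (cases "P \<in> Spec R")
    case True
    then show ?thesis unfolding zero_locus_def mem_Collect_eq Un_iff key[OF True] by simp
  qed (simp add: zero_locus_def)
  have "zero_locus R ?W = zero_locus R S \<union> zero_locus R T" by (rule Set.set_eqI) (rule mem)
  then have UV: "U \<inter> V = Spec R - zero_locus R ?W"
    using S(2) T(2) by blast
  show "\<exists>S\<subseteq>carrier R. U \<inter> V = Spec R - zero_locus R S"
  proof (cases "Spec R = {}")
    case True
    then have "U \<inter> V = Spec R - zero_locus R {}" using S(2) by simp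
    then show ?thesis by blast
  next
    case False
    then obtain P where "primeideal P R" by (auto simp: Spec_def)
    then interpret primeideal P R .
    have "?W \<subseteq> carrier R" using S(1) T(1) by auto
    then show ?thesis using UV by (intro exI[of _ ?W] conjI)
  qed
next
  fix \<U> assume "\<forall>U\<in>\<U>. \<exists>S\<subseteq>carrier R. U = Spec R - zero_locus R S"
  then obtain S where S: "\<And>U. U \<in> \<U> \<Longrightarrow> S U \<subseteq> carrier R \<and> U = Spec R - zero_locus R (S U)"
    by metis
  have "x \<in> \<Union>\<U> \<longleftrightarrow> x \<in> Spec R - zero_locus R (\<Union>(S ` \<U>))" for x
  proof -
    have "x \<in> U \<longleftrightarrow> x \<in> Spec R \<and> \<not> S U \<subseteq> x" if "U \<in> \<U>" for U
      using S[OF that] by (auto simp: zero_locus_def)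
    then show ?thesis by (auto simp: zero_locus_def) 
  qed
  then have "\<Union>\<U> = Spec R - zero_locus R (\<Union>(S ` \<U>))" by blast
  moreover have "\<Union>(S ` \<U>) \<subseteq> carrier R" using S by blast
  ultimately show "\<exists>S\<subseteq>carrier R. \<Union>\<U> = Spec R - zero_locus R S" by blast
qed

lemma openin_zariski:
  "openin (zariski R) U \<longleftrightarrow> (\<exists>S\<subseteq>carrier R. U = Spec R - zero_locus R S)"
  unfolding zariski_def by (simp only: topology_inverse'[OF istopology_zariski])

lemma topspace_zariski:
  assumes "cring R" shows "topspace (zariski R) = Spec R"
proof -
  interpret cring R by fact
  have "carrier R \<subseteq> P \<Longrightarrow> \<not> primeideal P R" for P
    by (metis ideal.Icarr primeideal.I_notcarr primeideal.axioms(1) subsetI subset_antisym)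
  then have "Spec R - zero_locus R (carrier R) = Spec R"
    by (auto simp: Spec_def zero_locus_def)
  then have "openin (zariski R) (Spec R)" unfolding openin_zariski by blast
  moreover have "openin (zariski R) U \<Longrightarrow> U \<subseteq> Spec R" for U
    unfolding openin_zariski by blast
  ultimately show ?thesis unfolding topspace_def by blast
qed

definition specialization_closed :: "'p topology \<Rightarrow> 'p set \<Rightarrow> bool" where
  "specialization_closed Y Z \<longleftrightarrow> Z \<subseteq> topspace Y \<and> (\<forall>z\<in>Z. Y closure_of {z} \<subseteq> Z)"

section \<open>A universe for the finitely generated modules\<close>

lemma module_transport:
  fixes R (structure) and M :: "('a, 'm) module" and g :: "'m \<Rightarrow> 'n"
  assumes M: "Module.module R M" and g: "inj_on g (carrier M)"
  shows "\<exists>N :: ('a, 'n) module. Module.module R N \<and> carrier N = g ` carrier M \<and> g \<in> module_hom R M N"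
proof -
  interpret Module.module R M by fact
  define h where "h = inv_into (carrier M) g"
  define N :: "('a, 'n) module" where
    "N = \<lparr>carrier = g ` carrier M, mult = undefined, one = undefined, zero = g \<zero>\<^bsub>M\<^esub>,
       add = \<lambda>x y. g (h x \<oplus>\<^bsub>M\<^esub> h y), smult = \<lambda>r x. g (r \<odot>\<^bsub>M\<^esub> h x)\<rparr>"
  have hg [simp]: "h (g x) = x" if "x \<in> carrier M" for x
    using g that by (simp add: h_def)
  have "abelian_group N"
  proof (rule abelian_groupI)
    fix x assume "x \<in> carrier N"
    then obtain u where u: "u \<in> carrier M" "x = g u" by (auto simp: N_def)
    then have "g (\<ominus>\<^bsub>M\<^esub> u) \<in> carrier N" "g (\<ominus>\<^bsub>M\<^esub> u) \<oplus>\<^bsub>N\<^esub> x = \<zero>\<^bsub>N\<^esub>"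
      by (auto simp: N_def M.l_neg)
    then show "\<exists>y\<in>carrier N. y \<oplus>\<^bsub>N\<^esub> x = \<zero>\<^bsub>N\<^esub>" by blast
  qed (auto simp: N_def M.a_ac)
  then have "Module.module R N"
    by (intro Module.moduleI is_cring)
      (auto simp: N_def smult_l_distr smult_r_distr smult_assoc1)
  moreover have "carrier N = g ` carrier M" "g \<in> module_hom R M N"
    by (auto simp: N_def module_hom_def)
  ultimately show ?thesis by blast
qed

lemma fin_gen_iso:
  assumes M: "Module.module R M" and N: "Module.module R N"
    and f: "f \<in> module_hom R M N" and surj: "f ` carrier M = carrier N"
    and inj: "inj_on f (carrier M)" and fg: "fin_gen R M"
  shows "fin_gen R N"
proof -
  interpret M: Module.module R M by fact
  interpret N: Module.module R N by fact
  have fcl: "f x \<in> carrier N" if "x \<in> carrier M" for x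
    using f that by (auto simp: module_hom_def)
  have fadd: "f (x \<oplus>\<^bsub>M\<^esub> y) = f x \<oplus>\<^bsub>N\<^esub> f y" if "x \<in> carrier M" "y \<in> carrier M" for x y
    using f that by (auto simp: module_hom_def)
  have fsm: "f (r \<odot>\<^bsub>M\<^esub> x) = r \<odot>\<^bsub>N\<^esub> f x" if "r \<in> carrier R" "x \<in> carrier M" for r x
    using f that by (auto simp: module_hom_def)
  have f0: "f \<zero>\<^bsub>M\<^esub> = \<zero>\<^bsub>N\<^esub>"
    using fsm[of "\<zero>\<^bsub>R\<^esub>" "\<zero>\<^bsub>M\<^esub>"] fcl by simp
  have fsum: "f (\<Oplus>\<^bsub>M\<^esub>a\<in>A. u a) = (\<Oplus>\<^bsub>N\<^esub>a\<in>A. f (u a))" if "finite A" "u \<in> A \<rightarrow> carrier M" for A u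
    using that
  proof (induction A rule: finite_induct)
    case empty
    then show ?case by (simp add: f0)
  next
    case (insert a A)
    then have u: "u \<in> A \<rightarrow> carrier M" "u a \<in> carrier M" by auto
    then have "(\<lambda>a. f (u a)) \<in> A \<rightarrow> carrier N" by (auto intro!: fcl)
    then show ?case using insert u by (simp add: fadd fcl)
  qed
  obtain A where A: "finite A" "A \<subseteq> carrier M"
    and gen: "\<And>x. x \<in> carrier M \<Longrightarrow> \<exists>c\<in>A \<rightarrow> carrier R. x = (\<Oplus>\<^bsub>M\<^esub>a\<in>A. c a \<odot>\<^bsub>M\<^esub> a)"
    using fg unfolding fin_gen_def by blast
  have injA: "inj_on f A" using inj A(2) by (rule inj_on_subset)
  show ?thesis unfolding fin_gen_def
  proof (intro exI[of _ "f ` A"] conjI ballI)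
    show "finite (f ` A)" "f ` A \<subseteq> carrier N" using A fcl by auto
    fix y assume "y \<in> carrier N"
    then obtain x where x: "x \<in> carrier M" "y = f x" using surj by blast
    then obtain c where c: "c \<in> A \<rightarrow> carrier R" "x = (\<Oplus>\<^bsub>M\<^esub>a\<in>A. c a \<odot>\<^bsub>M\<^esub> a)" using gen by blast
    have cA: "c a \<in> carrier R" "a \<in> carrier M" if "a \<in> A" for a using c(1) A(2) that by auto
    let ?d = "c \<circ> inv_into A f"
    have d: "?d \<in> f ` A \<rightarrow> carrier R" using c(1) injA by auto
    have "y = (\<Oplus>\<^bsub>N\<^esub>a\<in>A. f (c a \<odot>\<^bsub>M\<^esub> a))"
      unfolding x(2) c(2) using A c(1) by (intro fsum) auto
    also have "\<dots> = (\<Oplus>\<^bsub>N\<^esub>a\<in>A. ?d (f a) \<odot>\<^bsub>N\<^esub> f a)"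
      using injA by (intro N.M.finsum_cong') (auto simp: fsm cA intro!: N.smult_closed fcl)
    also have "\<dots> = (\<Oplus>\<^bsub>N\<^esub>b\<in>f ` A. ?d b \<odot>\<^bsub>N\<^esub> b)"
      using A c(1) injA by (intro N.M.finsum_reindex[symmetric]) (auto intro!: N.smult_closed fcl)
    finally show "\<exists>c\<in>f ` A \<rightarrow> carrier R. y = (\<Oplus>\<^bsub>N\<^esub>b\<in>f ` A. c b \<odot>\<^bsub>N\<^esub> b)" using d by blast
  qed
qed

lemma fg_module_iso_universe:
  fixes R :: "('a, 'r) ring_scheme" and M :: "('a, 'm) module"
  assumes "M \<in> fg_modules R"
  shows "\<exists>N :: ('a, (nat \<Rightarrow> 'a) set) module. N \<in> fg_modules R \<and> module_iso R M N"
proof -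
  have M: "Module.module R M" and fg: "fin_gen R M" using assms by (auto simp: fg_modules_def)
  interpret Module.module R M by fact
  obtain A where A: "finite A" "A \<subseteq> carrier M"
    and gen: "\<And>x. x \<in> carrier M \<Longrightarrow> \<exists>c\<in>A \<rightarrow> carrier R. x = (\<Oplus>\<^bsub>M\<^esub>a\<in>A. c a \<odot>\<^bsub>M\<^esub> a)"
    using fg unfolding fin_gen_def by blast
  obtain h :: "'m \<Rightarrow> nat" where h: "inj_on h A"
    using finite_imp_inj_to_nat_seg[OF A(1)] by blast
  define s where "s d = (\<Oplus>\<^bsub>M\<^esub>a\<in>A. d (h a) \<odot>\<^bsub>M\<^esub> a)" for d :: "nat \<Rightarrow> 'a"
  define g where "g x = {d. s d = x}" for x
  have ex: "\<exists>d. s d = x" if x: "x \<in> carrier M" for x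
  proof -
    obtain c where c: "c \<in> A \<rightarrow> carrier R" "x = (\<Oplus>\<^bsub>M\<^esub>a\<in>A. c a \<odot>\<^bsub>M\<^esub> a)" using gen[OF x] by blast
    have "s (c \<circ> inv_into A h) = x"
      unfolding s_def c(2) using A c(1) h by (intro M.finsum_cong') (auto simp: subset_iff)
    then show ?thesis by blast
  qed
  have inj: "inj_on g (carrier M)"
    using ex by (auto simp: inj_on_def g_def)
  then obtain N :: "('a, (nat \<Rightarrow> 'a) set) module"
    where N: "Module.module R N" "carrier N = g ` carrier M" "g \<in> module_hom R M N"
    using module_transport[OF M inj] by blast
  have "fin_gen R N" using fin_gen_iso[OF M N(1) N(3) N(2)[symmetric] inj fg] .
  then show ?thesis
    using N inj by (auto simp: fg_modules_def module_iso_def bij_betw_def)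
qed

end

theory Submission
  imports Defs
begin

text \<open>Everything rests on one criterion: for a finitely generated \<open>M\<close> and an arbitrary \<open>N\<close> over a
  noetherian ring, \<open>Hom(M, N) \<noteq> 0\<close> iff some \<open>P \<in> Ass N\<close> contains some \<open>Q \<in> Ass M\<close>
  (lemma \<open>hom_zero_iff_Ass\<close>). In textbook terms this says \<open>Ass Hom(M, N) = Supp M \<inter> Ass N\<close>, the
  support of \<open>M\<close> being the set of primes above \<open>Ass M\<close>.

  Given the criterion, a specialization-closed \<open>Z \<subseteq> Ass \<X>\<close> yields the pair consisting of
  \<open>{X | Ass X \<subseteq> Z}\<close> and \<open>{X | Ass X \<inter> Z = \<emptyset>}\<close>. The two classes are orthogonal because \<open>Z\<close> is closed
  upwards in \<open>Ass \<X>\<close>. They are each other's full orthogonal in \<open>\<X>\<close> because the modules with exactly one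
  associated prime, which the hypothesis provides, detect every prime: a nonzero map from \<open>X\<close> to
  the module at \<open>P\<close>, or back, exists as soon as \<open>P \<in> Ass X\<close>. Conversely a weak torsion pair
  \<open>(\<T>, \<F>)\<close> is recovered from \<open>Z = Ass \<T>\<close>. Membership in \<open>\<T>\<close> depends only on the primes above
  \<open>Ass X\<close>, so the module at \<open>P\<close> is in \<open>\<T>\<close> as soon as \<open>P\<close> lies above a prime in \<open>Ass \<T>\<close>, and
  \<open>Z\<close> is specialization-closed.

  The criterion is proved by hand, without localization or quotient modules. For one
  direction, a nonzero value \<open>f x\<close> has a multiple whose annihilator is a prime \<open>P\<close>; the same
  multiple of \<open>x\<close> has its annihilator inside \<open>P\<close>, and an annihilator that is maximal among those
  inside \<open>P\<close> is prime (lemma \<open>ann_smult_prime_avoiding\<close>). For the other, a homomorphism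
  \<open>M \<rightarrow> R/P \<hookrightarrow> N\<close> is written down in coordinates (lemma \<open>nonzero_hom_to_prime_cyclic\<close>).\<close>

section \<open>Annihilators of module elements\<close>

lemma (in noetherian_ring) ideal_family_has_maximal:
  assumes "\<I> \<noteq> {}" and "\<And>I. I \<in> \<I> \<Longrightarrow> ideal I R"
  shows "\<exists>I\<in>\<I>. \<forall>J\<in>\<I>. I \<subseteq> J \<longrightarrow> J = I"
proof (rule subset_Zorn)
  fix C assume C: "subset.chain \<I> C"
  show "\<exists>U\<in>\<I>. \<forall>I\<in>C. I \<subseteq> U"
  proof (cases "C = {}")
    case True
    then show ?thesis using assms(1) by blast
  next
    case False
    have "subset.chain {I. ideal I R} C"
      using C assms(2) by (auto simp: subset_chain_def)
    then have "\<Union>C \<in> C" using ideal_chain_is_trivial[OF False] by blast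
    then show ?thesis using C by (auto simp: subset_chain_def)
  qed
qed

lemma ideal_ann:
  assumes "Module.module R M" and x: "x \<in> carrier M"
  shows "ideal (ann R M x) R"
proof -
  interpret Module.module R M by fact
  have "subgroup (ann R M x) (add_monoid R)"
    by (rule R.add.subgroupI)
      (use x in \<open>auto simp: ann_def smult_l_distr smult_l_minus simp flip: a_inv_def\<close>)
  moreover have "ring R" by unfold_locales
  moreover have "a \<otimes>\<^bsub>R\<^esub> r \<in> ann R M x" "r \<otimes>\<^bsub>R\<^esub> a \<in> ann R M x"
    if "a \<in> ann R M x" "r \<in> carrier R" for a r
    using that x by (auto simp: ann_def smult_assoc1 R.m_comm[of a r])
  ultimately show ?thesis by (intro idealI) auto
qed

lemma smult_left_commute:
  assumes "Module.module R M" and "a \<in> carrier R" and "b \<in> carrier R" and "x \<in> carrier M"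
  shows "a \<odot>\<^bsub>M\<^esub> (b \<odot>\<^bsub>M\<^esub> x) = b \<odot>\<^bsub>M\<^esub> (a \<odot>\<^bsub>M\<^esub> x)"
proof -
  interpret Module.module R M by fact
  have "(a \<otimes>\<^bsub>R\<^esub> b) \<odot>\<^bsub>M\<^esub> x = (b \<otimes>\<^bsub>R\<^esub> a) \<odot>\<^bsub>M\<^esub> x"
    using assms by (simp only: R.m_comm)
  then show ?thesis using assms by (simp only: smult_assoc1)
qed

lemma ann_subset_ann_smult:
  assumes "Module.module R M" and "x \<in> carrier M" and "r \<in> carrier R"
  shows "ann R M x \<subseteq> ann R M (r \<odot>\<^bsub>M\<^esub> x)"
proof
  interpret Module.module R M by fact
  fix a assume a: "a \<in> ann R M x"
  then have "a \<odot>\<^bsub>M\<^esub> (r \<odot>\<^bsub>M\<^esub> x) = r \<odot>\<^bsub>M\<^esub> (a \<odot>\<^bsub>M\<^esub> x)"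
    using assms by (intro smult_left_commute) (auto simp: ann_def)
  then show "a \<in> ann R M (r \<odot>\<^bsub>M\<^esub> x)" using a assms by (simp add: ann_def)
qed

text \<open>Choose \<open>ann z\<close> maximal among the annihilators of multiples of \<open>y\<close> that avoid \<open>S\<close>. If
  \<open>ab \<in> ann z\<close>, then either \<open>ann (bz)\<close> still avoids \<open>S\<close>, so that it equals \<open>ann z\<close> and contains \<open>a\<close>,
  or some \<open>s \<in> S\<close> kills \<open>bz\<close>. In the second case \<open>ann (sz)\<close> avoids \<open>S\<close> because \<open>S\<close> is
  multiplicatively closed, so it equals \<open>ann z\<close>, and it contains \<open>b\<close>.

  With \<open>S = {1}\<close> this gives the existence of associated primes, and with \<open>S = R - P\<close> the existence
  of associated primes below a prime of the support.\<close>

lemma ann_smult_prime_avoiding: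
  assumes "noetherian_ring R" and "Module.module R M" and y: "y \<in> carrier M"
    and S: "S \<subseteq> carrier R" "\<one>\<^bsub>R\<^esub> \<in> S" "\<And>s t. s \<in> S \<Longrightarrow> t \<in> S \<Longrightarrow> s \<otimes>\<^bsub>R\<^esub> t \<in> S"
    and disj: "S \<inter> ann R M y = {}"
  shows "\<exists>r\<in>carrier R. primeideal (ann R M (r \<odot>\<^bsub>M\<^esub> y)) R \<and> S \<inter> ann R M (r \<odot>\<^bsub>M\<^esub> y) = {}"
proof -
  interpret noetherian_ring R by fact
  interpret Module.module R M by fact
  define \<I> where "\<I> = {ann R M (r \<odot>\<^bsub>M\<^esub> y) | r. r \<in> carrier R \<and> S \<inter> ann R M (r \<odot>\<^bsub>M\<^esub> y) = {}}"
  have "ann R M (\<one>\<^bsub>R\<^esub> \<odot>\<^bsub>M\<^esub> y) \<in> \<I>" unfolding \<I>_def using y disj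
    by (intro CollectI exI[of _ "\<one>\<^bsub>R\<^esub>"]) simp
  moreover have "ideal I R" if "I \<in> \<I>" for I
    using that y ideal_ann[OF assms(2)] by (auto simp: \<I>_def)
  ultimately obtain I where I: "I \<in> \<I>" and max: "\<And>J. J \<in> \<I> \<Longrightarrow> I \<subseteq> J \<Longrightarrow> J = I"
    using ideal_family_has_maximal[of \<I>] by blast
  then obtain r where r: "r \<in> carrier R" and Ir: "I = ann R M (r \<odot>\<^bsub>M\<^esub> y)" and SI: "S \<inter> I = {}"
    by (auto simp: \<I>_def)
  define z where "z = r \<odot>\<^bsub>M\<^esub> y"
  have z: "z \<in> carrier M" and Iz: "I = ann R M z" using r y by (auto simp: z_def Ir)
  have maxz: "ann R M (a \<odot>\<^bsub>M\<^esub> z) = I" if a: "a \<in> carrier R" and "S \<inter> ann R M (a \<odot>\<^bsub>M\<^esub> z) = {}" for a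
  proof (rule max)
    have "a \<odot>\<^bsub>M\<^esub> z = (a \<otimes>\<^bsub>R\<^esub> r) \<odot>\<^bsub>M\<^esub> y" using a r y by (simp add: z_def smult_assoc1)
    then show "ann R M (a \<odot>\<^bsub>M\<^esub> z) \<in> \<I>" unfolding \<I>_def using that r by auto
    show "I \<subseteq> ann R M (a \<odot>\<^bsub>M\<^esub> z)" unfolding Iz by (rule ann_subset_ann_smult[OF assms(2) z a])
  qed
  have "primeideal I R"
  proof (rule primeidealI)
    show "ideal I R" unfolding Iz by (rule ideal_ann[OF assms(2) z])
    show "cring R" by unfold_locales
    show "carrier R \<noteq> I" using S SI by blast
    fix a b assume a: "a \<in> carrier R" and b: "b \<in> carrier R" and ab: "a \<otimes>\<^bsub>R\<^esub> b \<in> I"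
    show "a \<in> I \<or> b \<in> I"
    proof (cases "S \<inter> ann R M (b \<odot>\<^bsub>M\<^esub> z) = {}")
      case True
      have "a \<in> ann R M (b \<odot>\<^bsub>M\<^esub> z)" using a b z ab by (simp add: Iz ann_def smult_assoc1)
      then show ?thesis using maxz[OF b True] by blast
    next
      case False
      then obtain s where s: "s \<in> S" "s \<in> carrier R" "s \<odot>\<^bsub>M\<^esub> (b \<odot>\<^bsub>M\<^esub> z) = \<zero>\<^bsub>M\<^esub>"
        by (auto simp: ann_def)
      have "S \<inter> ann R M (s \<odot>\<^bsub>M\<^esub> z) = {}"
      proof -
        have "t \<otimes>\<^bsub>R\<^esub> s \<in> S \<inter> I" if "t \<in> S" "t \<in> ann R M (s \<odot>\<^bsub>M\<^esub> z)" for t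
          using that S s z by (auto simp: Iz ann_def smult_assoc1)
        then show ?thesis using SI by blast
      qed
      then have "ann R M (s \<odot>\<^bsub>M\<^esub> z) = I" by (rule maxz[OF s(2)])
      moreover have "b \<in> ann R M (s \<odot>\<^bsub>M\<^esub> z)"
        using s b z smult_left_commute[OF assms(2) b s(2) z] by (simp add: ann_def)
      ultimately show ?thesis by blast
    qed
  qed
  then show ?thesis using r SI by (auto simp: Ir)
qed

lemma Ass_below_prime:
  assumes "noetherian_ring R" and "Module.module R M" and "primeideal P R"
    and "y \<in> carrier M" and "ann R M y \<subseteq> P"
  shows "\<exists>Q\<in>Ass R M. Q \<subseteq> P"
proof -
  interpret P: primeideal P R by fact
  interpret M: Module.module R M by fact
  have "\<exists>r\<in>carrier R. primeideal (ann R M (r \<odot>\<^bsub>M\<^esub> y)) R \<and>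
      (carrier R - P) \<inter> ann R M (r \<odot>\<^bsub>M\<^esub> y) = {}"
    by (rule ann_smult_prime_avoiding[OF assms(1,2,4)])
      (use assms(5) P.one_imp_carrier P.I_notcarr P.I_prime in auto)
  then show ?thesis using assms(4) by (fastforce simp: Ass_def ann_def)
qed

lemma ann_smult_prime:
  assumes "noetherian_ring R" and "Module.module R M"
    and "y \<in> carrier M" and "y \<noteq> \<zero>\<^bsub>M\<^esub>"
  shows "\<exists>r\<in>carrier R. primeideal (ann R M (r \<odot>\<^bsub>M\<^esub> y)) R"
proof -
  interpret M: Module.module R M by fact
  have "{\<one>\<^bsub>R\<^esub>} \<inter> ann R M y = {}" using assms by (simp add: ann_def)
  then show ?thesis
    using ann_smult_prime_avoiding[OF assms(1,2,3), of "{\<one>\<^bsub>R\<^esub>}"] by auto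
qed

section \<open>Vanishing of Hom\<close>

lemma module_hom_zero:
  assumes "Module.module R M" and "Module.module R N" and "f \<in> module_hom R M N"
  shows "f \<zero>\<^bsub>M\<^esub> = \<zero>\<^bsub>N\<^esub>"
proof -
  interpret M: Module.module R M by fact
  interpret N: Module.module R N by fact
  have "f (\<zero>\<^bsub>R\<^esub> \<odot>\<^bsub>M\<^esub> \<zero>\<^bsub>M\<^esub>) = \<zero>\<^bsub>R\<^esub> \<odot>\<^bsub>N\<^esub> f \<zero>\<^bsub>M\<^esub>" "f \<zero>\<^bsub>M\<^esub> \<in> carrier N"
    using assms(3) M.R.zero_closed M.M.zero_closed unfolding module_hom_def by blast+
  then show ?thesis by simp
qed

lemma ann_subset_ann_image:
  assumes "Module.module R M" and "Module.module R N" and "f \<in> module_hom R M N"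
    and "x \<in> carrier M"
  shows "ann R M x \<subseteq> ann R N (f x)"
  using module_hom_zero[OF assms(1-3)] assms(3,4) by (force simp: ann_def module_hom_def)

definition lin_span :: "('a, 'r) ring_scheme \<Rightarrow> ('a, 'm) module \<Rightarrow> 'm set \<Rightarrow> 'm set" where
  "lin_span R M B = {\<Oplus>\<^bsub>M\<^esub>a\<in>B. c a \<odot>\<^bsub>M\<^esub> a | c. c \<in> B \<rightarrow> carrier R}"

lemma lin_spanE:
  assumes "x \<in> lin_span R M B"
  obtains c where "c \<in> B \<rightarrow> carrier R" and "x = (\<Oplus>\<^bsub>M\<^esub>a\<in>B. c a \<odot>\<^bsub>M\<^esub> a)"
  using assms by (auto simp: lin_span_def)

lemma submodule_lin_span:
  assumes M: "Module.module R M" and B: "finite B" "B \<subseteq> carrier M"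
  shows "submodule (lin_span R M B) R M"
proof -
  interpret M: Module.module R M by fact
  have carr: "lin_span R M B \<subseteq> carrier M"
  proof
    fix x assume "x \<in> lin_span R M B"
    then obtain c where c: "c \<in> B \<rightarrow> carrier R" "x = (\<Oplus>\<^bsub>M\<^esub>a\<in>B. c a \<odot>\<^bsub>M\<^esub> a)" by (rule lin_spanE)
    show "x \<in> carrier M"
      unfolding c(2) using c(1) B(2) by (intro M.M.finsum_closed) (auto intro!: M.smult_closed)
  qed
  have smult: "r \<odot>\<^bsub>M\<^esub> x \<in> lin_span R M B" if r: "r \<in> carrier R" and x: "x \<in> lin_span R M B" for r x
  proof -
    obtain c where c: "c \<in> B \<rightarrow> carrier R" "x = (\<Oplus>\<^bsub>M\<^esub>a\<in>B. c a \<odot>\<^bsub>M\<^esub> a)"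
      using x by (rule lin_spanE)
    have ca: "c a \<in> carrier R" "a \<in> carrier M" if "a \<in> B" for a
      using that B c by auto
    have "r \<odot>\<^bsub>M\<^esub> x = (\<Oplus>\<^bsub>M\<^esub>a\<in>B. r \<odot>\<^bsub>M\<^esub> (c a \<odot>\<^bsub>M\<^esub> a))"
      unfolding c(2) using ca r B by (intro M.finsum_smult_ldistr) auto
    also have "\<dots> = (\<Oplus>\<^bsub>M\<^esub>a\<in>B. (r \<otimes>\<^bsub>R\<^esub> c a) \<odot>\<^bsub>M\<^esub> a)"
      using ca r by (intro M.M.finsum_cong') (auto simp: M.smult_assoc1)
    finally show ?thesis unfolding lin_span_def using ca r
      by (auto intro!: exI[of _ "\<lambda>a. r \<otimes>\<^bsub>R\<^esub> c a"])
  qed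
  show ?thesis
  proof (rule M.submoduleI[OF carr _ _ _ smult])
    have "(\<Oplus>\<^bsub>M\<^esub>a\<in>B. \<zero>\<^bsub>R\<^esub> \<odot>\<^bsub>M\<^esub> a) = \<zero>\<^bsub>M\<^esub>"
      using B by (intro M.M.add.finprod_one_eqI) auto
    then show "\<zero>\<^bsub>M\<^esub> \<in> lin_span R M B"
      unfolding lin_span_def by (intro CollectI exI[of _ "\<lambda>_. \<zero>\<^bsub>R\<^esub>"]) simp
  next
    fix x assume x: "x \<in> lin_span R M B"
    then have "\<ominus>\<^bsub>M\<^esub> x = (\<ominus>\<^bsub>R\<^esub> \<one>\<^bsub>R\<^esub>) \<odot>\<^bsub>M\<^esub> x" using subsetD[OF carr x] by (simp add: M.smult_l_minus)
    then show "\<ominus>\<^bsub>M\<^esub> x \<in> lin_span R M B" using smult[OF _ x, of "\<ominus>\<^bsub>R\<^esub> \<one>\<^bsub>R\<^esub>"] by simp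
  next
    fix x y assume x: "x \<in> lin_span R M B" and y: "y \<in> lin_span R M B"
    obtain c where c: "c \<in> B \<rightarrow> carrier R" "x = (\<Oplus>\<^bsub>M\<^esub>a\<in>B. c a \<odot>\<^bsub>M\<^esub> a)"
      using x by (rule lin_spanE)
    obtain d where d: "d \<in> B \<rightarrow> carrier R" "y = (\<Oplus>\<^bsub>M\<^esub>a\<in>B. d a \<odot>\<^bsub>M\<^esub> a)"
      using y by (rule lin_spanE)
    have cd: "c a \<in> carrier R" "d a \<in> carrier R" "a \<in> carrier M" if "a \<in> B" for a
      using that B c d by auto
    have "x \<oplus>\<^bsub>M\<^esub> y = (\<Oplus>\<^bsub>M\<^esub>a\<in>B. c a \<odot>\<^bsub>M\<^esub> a \<oplus>\<^bsub>M\<^esub> d a \<odot>\<^bsub>M\<^esub> a)"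
      unfolding c(2) d(2) using cd by (intro M.M.finsum_addf[symmetric]) auto
    also have "\<dots> = (\<Oplus>\<^bsub>M\<^esub>a\<in>B. (c a \<oplus>\<^bsub>R\<^esub> d a) \<odot>\<^bsub>M\<^esub> a)"
      using cd by (intro M.M.finsum_cong') (auto simp: M.smult_l_distr)
    finally show "x \<oplus>\<^bsub>M\<^esub> y \<in> lin_span R M B" unfolding lin_span_def using cd
      by (auto intro!: exI[of _ "\<lambda>a. c a \<oplus>\<^bsub>R\<^esub> d a"])
  qed
qed

lemma lin_span_insertE:
  assumes M: "Module.module R M" and C: "finite C" "C \<subseteq> carrier M" "b \<in> carrier M" "b \<notin> C"
    and x: "x \<in> lin_span R M (insert b C)"
  obtains r u where "r \<in> carrier R" and "u \<in> lin_span R M C" and "x = r \<odot>\<^bsub>M\<^esub> b \<oplus>\<^bsub>M\<^esub> u"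
proof -
  interpret M: Module.module R M by fact
  obtain c where c: "c \<in> insert b C \<rightarrow> carrier R" "x = (\<Oplus>\<^bsub>M\<^esub>a\<in>insert b C. c a \<odot>\<^bsub>M\<^esub> a)"
    using x by (rule lin_spanE)
  show thesis
  proof (rule that)
    show "x = c b \<odot>\<^bsub>M\<^esub> b \<oplus>\<^bsub>M\<^esub> (\<Oplus>\<^bsub>M\<^esub>a\<in>C. c a \<odot>\<^bsub>M\<^esub> a)"
      unfolding c(2) using c(1) C by (intro M.M.finsum_insert) auto
  qed (use c(1) in \<open>auto simp: lin_span_def\<close>)
qed

text \<open>The localization \<open>M\<^sub>P\<close> is nonzero, hence so is \<open>M\<^sub>P / P M\<^sub>P\<close>, and a coordinate of this vector
  space with denominators cleared is a nonzero map \<open>M \<rightarrow> R/P\<close>. Here is the same map without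
  localization. Among the subsets of a finite generating set let \<open>B\<close> be one of least size such
  that \<open>sM \<subseteq> \<langle>B\<rangle>\<close> for some \<open>s \<notin> P\<close>; this is a minimal generating set of \<open>M\<^sub>P\<close>. It is nonempty, since \<open>sy \<noteq> 0\<close>. Fix \<open>b \<in> B\<close> and
  put \<open>C = B - {b}\<close>. Minimality forces \<open>r \<in> P\<close> whenever \<open>rb \<in> \<langle>C\<rangle>\<close>. Hence, writing
  \<open>sx = rb + u\<close> with \<open>u \<in> \<langle>C\<rangle>\<close>, the scalar \<open>r\<close> is determined modulo \<open>P = ann n\<close>, and \<open>x \<mapsto> r n\<close> is a
  well-defined homomorphism. It sends \<open>b\<close> to \<open>s n \<noteq> 0\<close>.\<close>

lemma nonzero_hom_to_prime_cyclic:
  assumes M: "Module.module R M" and fg: "fin_gen R M" and N: "Module.module R N"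
    and n: "n \<in> carrier N" and P: "P = ann R N n" "primeideal P R"
    and y: "y \<in> carrier M" "ann R M y \<subseteq> P"
  shows "\<not> hom_zero R M N"
proof -
  interpret P: primeideal P R by fact
  interpret M: Module.module R M by fact
  interpret N: Module.module R N by fact
  obtain A where A: "finite A" "A \<subseteq> carrier M"
    and genA: "\<forall>x\<in>carrier M. \<exists>c\<in>A \<rightarrow> carrier R. x = (\<Oplus>\<^bsub>M\<^esub>a\<in>A. c a \<odot>\<^bsub>M\<^esub> a)"
    using fg unfolding fin_gen_def by (elim exE conjE)
  have gen: "carrier M \<subseteq> lin_span R M A"
    using genA by (auto simp: lin_span_def)
  have one: "\<one>\<^bsub>R\<^esub> \<notin> P" using P.one_imp_carrier P.I_notcarr by blast
  define good where
    "good B \<longleftrightarrow> B \<subseteq> A \<and> (\<exists>s\<in>carrier R - P. \<forall>x\<in>carrier M. s \<odot>\<^bsub>M\<^esub> x \<in> lin_span R M B)" for B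
  have "good A" unfolding good_def using gen one by (auto intro!: bexI[of _ "\<one>\<^bsub>R\<^esub>"])
  then obtain B where B: "good B" and min: "\<And>C. good C \<Longrightarrow> card B \<le> card C"
    using arg_min_natI[of good A card] arg_min_nat_le[of good _ card] by metis
  obtain s where BA: "B \<subseteq> A" and s: "s \<in> carrier R" "s \<notin> P"
    and sM: "\<And>x. x \<in> carrier M \<Longrightarrow> s \<odot>\<^bsub>M\<^esub> x \<in> lin_span R M B"
    using B by (auto simp: good_def)
  have finB: "finite B" using BA A finite_subset by blast
  have "B \<noteq> {}"
  proof
    assume "B = {}"
    then have "s \<odot>\<^bsub>M\<^esub> y = \<zero>\<^bsub>M\<^esub>" using sM[OF y(1)] by (simp add: lin_span_def)
    then show False using s y by (auto simp: ann_def)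
  qed
  then obtain b where b: "b \<in> B" by blast
  define C where "C = B - {b}"
  have C: "C \<subseteq> A" "finite C" "b \<notin> C" "B = insert b C" "C \<subseteq> carrier M" and bM: "b \<in> carrier M"
    unfolding C_def using b BA A finB by blast+
  note submod = submodule_lin_span[OF M C(2,5)]
  note span_carrC = subsetD[OF M.submoduleE(1)[OF submod]]
    and span_minus = M.submoduleE(3)[OF submod]
    and span_smult = M.submoduleE(4)[OF submod]
    and span_add = M.submoduleE(5)[OF submod]
  have decomp: "\<exists>r\<in>carrier R. \<exists>u\<in>lin_span R M C. x = r \<odot>\<^bsub>M\<^esub> b \<oplus>\<^bsub>M\<^esub> u" if "x \<in> lin_span R M B" for x
    using lin_span_insertE[OF M C(2,5) bM C(3) that[unfolded C(4)]] by blast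
  \<comment> \<open>Otherwise \<open>rs\<close> is outside \<open>P\<close> and carries \<open>M\<close> into the span of the smaller set \<open>C\<close>.\<close>
  have coord: "r \<in> P" if r: "r \<in> carrier R" "r \<odot>\<^bsub>M\<^esub> b \<in> lin_span R M C" for r
  proof (rule ccontr)
    assume "r \<notin> P"
    then have "r \<otimes>\<^bsub>R\<^esub> s \<in> carrier R - P" using r s P.I_prime by auto
    moreover have "(r \<otimes>\<^bsub>R\<^esub> s) \<odot>\<^bsub>M\<^esub> x \<in> lin_span R M C" if x: "x \<in> carrier M" for x
    proof -
      obtain q u where q: "q \<in> carrier R" "u \<in> lin_span R M C" "s \<odot>\<^bsub>M\<^esub> x = q \<odot>\<^bsub>M\<^esub> b \<oplus>\<^bsub>M\<^esub> u"
        using decomp[OF sM[OF x]] by blast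
      have "(r \<otimes>\<^bsub>R\<^esub> s) \<odot>\<^bsub>M\<^esub> x = r \<odot>\<^bsub>M\<^esub> (q \<odot>\<^bsub>M\<^esub> b) \<oplus>\<^bsub>M\<^esub> r \<odot>\<^bsub>M\<^esub> u"
        using r s x q bM span_carrC by (simp add: M.smult_assoc1 M.smult_r_distr)
      also have "r \<odot>\<^bsub>M\<^esub> (q \<odot>\<^bsub>M\<^esub> b) = q \<odot>\<^bsub>M\<^esub> (r \<odot>\<^bsub>M\<^esub> b)"
        using r q bM by (intro smult_left_commute[OF M])
      finally show ?thesis using r q by (auto intro!: span_add span_smult)
    qed
    ultimately have "good C" using C(1) by (auto simp: good_def)
    then have "card B \<le> card C" by (rule min)
    then show False using C by simp
  qed
  \<comment> \<open>\<open>r\<close> is a possible \<open>b\<close>-coordinate of \<open>s x\<close>.\<close>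
  define rel where
    "rel x r \<longleftrightarrow> r \<in> carrier R \<and> (\<exists>u\<in>lin_span R M C. s \<odot>\<^bsub>M\<^esub> x = r \<odot>\<^bsub>M\<^esub> b \<oplus>\<^bsub>M\<^esub> u)" for x r
  have rel_ex: "\<exists>r. rel x r" if "x \<in> carrier M" for x
    using decomp[OF sM[OF that]] by (auto simp: rel_def)
  have rel_unique: "r \<odot>\<^bsub>N\<^esub> n = r' \<odot>\<^bsub>N\<^esub> n" if rel: "rel x r" "rel x r'" for x r r'
  proof -
    obtain u u' where r: "r \<in> carrier R" "r' \<in> carrier R" and u: "u \<in> lin_span R M C" "u' \<in> lin_span R M C"
      and eq: "r \<odot>\<^bsub>M\<^esub> b \<oplus>\<^bsub>M\<^esub> u = r' \<odot>\<^bsub>M\<^esub> b \<oplus>\<^bsub>M\<^esub> u'"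
      using rel unfolding rel_def by metis
    have uM: "u \<in> carrier M" "u' \<in> carrier M" using u span_carrC by auto
    have "(r \<ominus>\<^bsub>R\<^esub> r') \<odot>\<^bsub>M\<^esub> b = r \<odot>\<^bsub>M\<^esub> b \<oplus>\<^bsub>M\<^esub> \<ominus>\<^bsub>M\<^esub> (r' \<odot>\<^bsub>M\<^esub> b)"
      using r bM by (simp add: P.minus_eq M.smult_l_distr M.smult_l_minus)
    also have "\<dots> = ((r \<odot>\<^bsub>M\<^esub> b \<oplus>\<^bsub>M\<^esub> u) \<oplus>\<^bsub>M\<^esub> \<ominus>\<^bsub>M\<^esub> u) \<oplus>\<^bsub>M\<^esub> \<ominus>\<^bsub>M\<^esub> (r' \<odot>\<^bsub>M\<^esub> b)"
      using r bM uM by (simp add: M.M.a_assoc M.M.r_neg)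
    also have "\<dots> = u' \<oplus>\<^bsub>M\<^esub> \<ominus>\<^bsub>M\<^esub> u"
      unfolding eq using r bM uM
      by (simp add: M.M.a_ac M.M.r_neg2 M.M.r_neg)
    finally have "(r \<ominus>\<^bsub>R\<^esub> r') \<odot>\<^bsub>M\<^esub> b = u' \<oplus>\<^bsub>M\<^esub> \<ominus>\<^bsub>M\<^esub> u" .
    then have "r \<ominus>\<^bsub>R\<^esub> r' \<in> P" using coord[of "r \<ominus>\<^bsub>R\<^esub> r'"] span_add[OF u(2) span_minus[OF u(1)]] r by simp
    then have "(r \<ominus>\<^bsub>R\<^esub> r') \<odot>\<^bsub>N\<^esub> n = \<zero>\<^bsub>N\<^esub>"
      unfolding P(1) ann_def by blast
    moreover have "(r \<ominus>\<^bsub>R\<^esub> r') \<odot>\<^bsub>N\<^esub> n = r \<odot>\<^bsub>N\<^esub> n \<oplus>\<^bsub>N\<^esub> \<ominus>\<^bsub>N\<^esub> (r' \<odot>\<^bsub>N\<^esub> n)"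
      using r n by (simp add: P.minus_eq N.smult_l_distr N.smult_l_minus)
    ultimately show ?thesis
      using r n N.M.minus_equality[of "r \<odot>\<^bsub>N\<^esub> n" "\<ominus>\<^bsub>N\<^esub> (r' \<odot>\<^bsub>N\<^esub> n)"] by simp
  qed
  define g where "g x = (SOME r. rel x r) \<odot>\<^bsub>N\<^esub> n" for x
  have g_eq: "g x = r \<odot>\<^bsub>N\<^esub> n" if "rel x r" for x r
    unfolding g_def by (rule rel_unique[OF someI[of "rel x", OF that] that])
  have "g \<in> module_hom R M N"
    unfolding module_hom_def
  proof (intro CollectI conjI ballI funcsetI)
    fix x assume x: "x \<in> carrier M"
    obtain r where r: "rel x r" using rel_ex[OF x] by blast
    then show "g x \<in> carrier N" using n by (auto simp: g_eq rel_def)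
    from r obtain u where ru: "r \<in> carrier R" "u \<in> lin_span R M C" "s \<odot>\<^bsub>M\<^esub> x = r \<odot>\<^bsub>M\<^esub> b \<oplus>\<^bsub>M\<^esub> u"
      by (auto simp: rel_def)
    {
      fix x' assume x': "x' \<in> carrier M"
      obtain r' where r': "rel x' r'" using rel_ex[OF x'] by blast
      then obtain u' where ru': "r' \<in> carrier R" "u' \<in> lin_span R M C" "s \<odot>\<^bsub>M\<^esub> x' = r' \<odot>\<^bsub>M\<^esub> b \<oplus>\<^bsub>M\<^esub> u'"
        by (auto simp: rel_def)
      have "s \<odot>\<^bsub>M\<^esub> (x \<oplus>\<^bsub>M\<^esub> x') = (r \<odot>\<^bsub>M\<^esub> b \<oplus>\<^bsub>M\<^esub> u) \<oplus>\<^bsub>M\<^esub> (r' \<odot>\<^bsub>M\<^esub> b \<oplus>\<^bsub>M\<^esub> u')"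
        using x x' s ru(3) ru'(3) by (simp add: M.smult_r_distr)
      also have "\<dots> = (r \<oplus>\<^bsub>R\<^esub> r') \<odot>\<^bsub>M\<^esub> b \<oplus>\<^bsub>M\<^esub> (u \<oplus>\<^bsub>M\<^esub> u')"
        using ru ru' bM span_carrC by (simp add: M.smult_l_distr M.M.a_ac)
      finally have "rel (x \<oplus>\<^bsub>M\<^esub> x') (r \<oplus>\<^bsub>R\<^esub> r')"
        using ru ru' span_add by (auto simp: rel_def)
      then show "g (x \<oplus>\<^bsub>M\<^esub> x') = g x \<oplus>\<^bsub>N\<^esub> g x'"
        using ru ru' n by (simp add: g_eq[OF r] g_eq[OF r'] g_eq N.smult_l_distr)
    }
    fix a assume a: "a \<in> carrier R"
    have "s \<odot>\<^bsub>M\<^esub> (a \<odot>\<^bsub>M\<^esub> x) = a \<odot>\<^bsub>M\<^esub> (s \<odot>\<^bsub>M\<^esub> x)"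
      using s a x by (intro smult_left_commute[OF M])
    also have "\<dots> = (a \<otimes>\<^bsub>R\<^esub> r) \<odot>\<^bsub>M\<^esub> b \<oplus>\<^bsub>M\<^esub> a \<odot>\<^bsub>M\<^esub> u"
      using ru a bM span_carrC by (simp add: M.smult_r_distr M.smult_assoc1)
    finally have "rel (a \<odot>\<^bsub>M\<^esub> x) (a \<otimes>\<^bsub>R\<^esub> r)"
      using ru a span_smult by (auto simp: rel_def)
    then show "g (a \<odot>\<^bsub>M\<^esub> x) = a \<odot>\<^bsub>N\<^esub> g x"
      using ru a n by (simp add: g_eq[OF r] g_eq N.smult_assoc1)
  qed
  moreover have "g b \<noteq> \<zero>\<^bsub>N\<^esub>"
  proof -
    have "\<zero>\<^bsub>M\<^esub> \<in> lin_span R M C"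
      using span_smult[of "\<zero>\<^bsub>R\<^esub>"] M.submoduleE(2)[OF submod] span_carrC by fastforce
    moreover have "s \<odot>\<^bsub>M\<^esub> b = s \<odot>\<^bsub>M\<^esub> b \<oplus>\<^bsub>M\<^esub> \<zero>\<^bsub>M\<^esub>" using s bM by simp
    ultimately have "rel b s" using s(1) unfolding rel_def by blast
    then have "g b = s \<odot>\<^bsub>N\<^esub> n" by (rule g_eq)
    moreover have "s \<odot>\<^bsub>N\<^esub> n \<noteq> \<zero>\<^bsub>N\<^esub>" using s unfolding P(1) ann_def by blast
    ultimately show ?thesis by simp
  qed
  ultimately show ?thesis using bM by (auto simp: hom_zero_def)
qed

lemma hom_zero_iff_Ass:
  assumes noeth: "noetherian_ring R" and M: "M \<in> fg_modules R" and N: "Module.module R N"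
  shows "hom_zero R M N \<longleftrightarrow> \<not> (\<exists>P\<in>Ass R N. \<exists>Q\<in>Ass R M. Q \<subseteq> P)"
proof
  have M': "Module.module R M" "fin_gen R M" using M by (auto simp: fg_modules_def)
  assume "hom_zero R M N"
  then show "\<not> (\<exists>P\<in>Ass R N. \<exists>Q\<in>Ass R M. Q \<subseteq> P)"
    using nonzero_hom_to_prime_cyclic[OF M' N] by (auto simp: Ass_def)
next
  have M': "Module.module R M" using M by (auto simp: fg_modules_def)
  interpret M: Module.module R M by fact
  assume *: "\<not> (\<exists>P\<in>Ass R N. \<exists>Q\<in>Ass R M. Q \<subseteq> P)"
  show "hom_zero R M N"
    unfolding hom_zero_def
  proof (intro ballI, rule ccontr)
    fix f x assume f: "f \<in> module_hom R M N" and x: "x \<in> carrier M" and nz: "f x \<noteq> \<zero>\<^bsub>N\<^esub>"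
    have "f x \<in> carrier N" using f x by (auto simp: module_hom_def)
    then obtain r where r: "r \<in> carrier R" and prime: "primeideal (ann R N (r \<odot>\<^bsub>N\<^esub> f x)) R"
      using ann_smult_prime[OF noeth N] nz by blast
    have rx: "r \<odot>\<^bsub>M\<^esub> x \<in> carrier M" and frx: "r \<odot>\<^bsub>N\<^esub> f x = f (r \<odot>\<^bsub>M\<^esub> x)"
      using f r x by (auto simp: module_hom_def)
    have "f (r \<odot>\<^bsub>M\<^esub> x) \<in> carrier N" using f rx by (auto simp: module_hom_def)
    then have "ann R N (f (r \<odot>\<^bsub>M\<^esub> x)) \<in> Ass R N" using prime unfolding frx Ass_def by blast
    moreover have "\<exists>Q\<in>Ass R M. Q \<subseteq> ann R N (f (r \<odot>\<^bsub>M\<^esub> x))"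
      using Ass_below_prime[OF noeth M' prime[unfolded frx] rx ann_subset_ann_image[OF M' N f rx]] .
    ultimately show False using * by blast
  qed
qed

section \<open>Isomorphism invariance and specialization\<close>

lemma Ass_module_iso:
  assumes M: "Module.module R M" and N: "Module.module R N" and "module_iso R M N"
  shows "Ass R N = Ass R M"
proof -
  interpret M: Module.module R M by fact
  obtain f where f: "f \<in> module_hom R M N" and bij: "bij_betw f (carrier M) (carrier N)"
    using assms(3) by (auto simp: module_iso_def)
  have "ann R N (f x) = ann R M x" if x: "x \<in> carrier M" for x
  proof
    show "ann R M x \<subseteq> ann R N (f x)" by (rule ann_subset_ann_image[OF M N f x])
    show "ann R N (f x) \<subseteq> ann R M x"
    proof
      fix r assume r: "r \<in> ann R N (f x)"
      then have "f (r \<odot>\<^bsub>M\<^esub> x) = f \<zero>\<^bsub>M\<^esub>"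
        using f x module_hom_zero[OF M N f] by (auto simp: ann_def module_hom_def)
      then have "r \<odot>\<^bsub>M\<^esub> x = \<zero>\<^bsub>M\<^esub>"
        using bij r x by (auto simp: bij_betw_def inj_on_def ann_def)
      then show "r \<in> ann R M x" using r by (simp add: ann_def)
    qed
  qed
  moreover have "carrier N = f ` carrier M" using bij by (simp add: bij_betw_def)
  ultimately show ?thesis by (simp add: Ass_def)
qed

text \<open>The members of a torsion pair have to be closed under isomorphism. Classes cut out of \<open>\<X>\<close>
  by their associated primes are, because \<open>Ass\<close> is an isomorphism invariant.\<close>

lemma subcategory_Ass_restrict:
  assumes "subcategory R \<X>"
  shows "subcategory R {X \<in> \<X>. \<Phi> (Ass R X)}"
  using assms Ass_module_iso unfolding subcategory_def fg_modules_def by fastforce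

text \<open>The Zariski closure of a point \<open>Q\<close> is \<open>V(Q)\<close>, so specialization-closed means closed upwards
  with respect to inclusion.\<close>

lemma specialization_closed_zariski_iff:
  assumes "cring R" and "A \<subseteq> Spec R"
  shows "specialization_closed (subtopology (zariski R) A) Z \<longleftrightarrow>
    Z \<subseteq> A \<and> (\<forall>Q\<in>Z. \<forall>P\<in>A. Q \<subseteq> P \<longrightarrow> P \<in> Z)"
proof -
  have cl: "(P \<in> zariski R closure_of {Q}) \<longleftrightarrow> Q \<subseteq> P" if "Q \<in> Spec R" "P \<in> Spec R" for P Q
  proof
    have Q: "Q \<subseteq> carrier R"
      using that(1) unfolding Spec_def
      by (simp add: additive_subgroup.a_subset ideal.axioms(1) primeideal.axioms(1))
    assume P: "P \<in> zariski R closure_of {Q}"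
    have "openin (zariski R) (Spec R - zero_locus R Q)" using Q by (auto simp: openin_zariski)
    then have "P \<in> Spec R - zero_locus R Q \<longrightarrow> Q \<in> Spec R - zero_locus R Q"
      using P unfolding in_closure_of by blast
    then show "Q \<subseteq> P" using that by (auto simp: zero_locus_def)
  next
    assume "Q \<subseteq> P"
    then show "P \<in> zariski R closure_of {Q}"
      using that by (auto simp: in_closure_of openin_zariski topspace_zariski[OF assms(1)] zero_locus_def)
  qed
  have "subtopology (zariski R) A closure_of {Q} = {P \<in> A. Q \<subseteq> P}" if "Q \<in> A" for Q
  proof -
    have "(P \<in> zariski R closure_of {Q}) \<longleftrightarrow> Q \<subseteq> P" if "P \<in> A" for P
      using \<open>Q \<in> A\<close> that assms(2) by (intro cl) auto
    then show ?thesis using that by (auto simp: closure_of_subtopology)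
  qed
  moreover have "topspace (subtopology (zariski R) A) = A"
    using assms(2) by (auto simp: topspace_zariski[OF assms(1)])
  ultimately show ?thesis unfolding specialization_closed_def by blast
qed

section \<open>The bijection\<close>

theorem theorem1p3:
  fixes R :: "('a, 'r) ring_scheme" and \<X> :: "('a, 'm) module set"
  assumes "cring R" and "noetherian_ring R"
    and "subcategory R \<X>"
    and "\<forall>P\<in>Ass_sub R \<X>. \<exists>X\<in>\<X>. Ass R X = {P}"
  shows "\<exists>\<phi>. bij_betw \<phi> {(\<T>, \<F>). weak_torsion_pair R \<X> \<T> \<F>}
    {Z. specialization_closed (subtopology (zariski R) (Ass_sub R \<X>)) Z}"
proof -
  let ?A = "Ass_sub R \<X>"
  define tors where "tors Z = {X \<in> \<X>. Ass R X \<subseteq> Z}" for Z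
  define free where "free Z = {X \<in> \<X>. Ass R X \<inter> Z = {}}" for Z
  have "?A \<subseteq> Spec R" by (auto simp: Ass_sub_def Ass_def Spec_def)
  note closed_iff = specialization_closed_zariski_iff[OF assms(1) this]
  have AssA: "P \<in> ?A" if "X \<in> \<X>" "P \<in> Ass R X" for X P
    using that by (auto simp: Ass_sub_def)
  \<comment> \<open>\<open>W P\<close> is the test module with the single associated prime \<open>P\<close>.\<close>
  obtain W where W: "\<And>P. P \<in> ?A \<Longrightarrow> W P \<in> \<X> \<and> Ass R (W P) = {P}"
    using assms(4) by metis
  have hom: "hom_zero R X Y \<longleftrightarrow> \<not> (\<exists>P\<in>Ass R Y. \<exists>Q\<in>Ass R X. Q \<subseteq> P)"
    if "X \<in> \<X>" "Y \<in> \<X>" for X Y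
    using that assms(3) by (intro hom_zero_iff_Ass[OF assms(2)])
      (auto simp: subcategory_def fg_modules_def)
  have pair: "weak_torsion_pair R \<X> (tors Z) (free Z)" and Ass_tors: "Ass_sub R (tors Z) = Z"
    if "Z \<subseteq> ?A" and up: "\<And>P Q. Q \<in> Z \<Longrightarrow> P \<in> ?A \<Longrightarrow> Q \<subseteq> P \<Longrightarrow> P \<in> Z" for Z
  proof -
    have WZ: "W P \<in> tors Z" if "P \<in> Z" for P
      using W \<open>Z \<subseteq> ?A\<close> that by (auto simp: tors_def)
    have WF: "W P \<in> free Z" if "P \<in> ?A" "P \<notin> Z" for P
      using W that by (auto simp: free_def)
    show "Ass_sub R (tors Z) = Z"
    proof
      show "Ass_sub R (tors Z) \<subseteq> Z" by (auto simp: Ass_sub_def tors_def)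
      show "Z \<subseteq> Ass_sub R (tors Z)"
      proof
        fix P assume P: "P \<in> Z"
        then have "P \<in> Ass R (W P)" using W \<open>Z \<subseteq> ?A\<close> by blast
        then show "P \<in> Ass_sub R (tors Z)" unfolding Ass_sub_def using WZ[OF P] by (rule UN_I[rotated])
      qed
    qed
    have orth: "hom_zero R T F" if "T \<in> tors Z" "F \<in> free Z" for T F
    proof -
      have TF: "T \<in> \<X>" "Ass R T \<subseteq> Z" "F \<in> \<X>" "Ass R F \<inter> Z = {}"
        using that by (auto simp: tors_def free_def)
      have "P \<in> Z" if "P \<in> Ass R F" "Q \<in> Ass R T" "Q \<subseteq> P" for P Q
        using that TF up[of Q P] AssA[of F P] by blast
      then show ?thesis using TF by (auto simp: hom)
    qed
    have T: "X \<in> tors Z" if X: "X \<in> \<X>" and "\<forall>F\<in>free Z. hom_zero R X F" for X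
    proof -
      have "P \<in> Z" if P: "P \<in> Ass R X" for P
      proof (rule ccontr)
        assume "P \<notin> Z"
        then have "W P \<in> free Z" using WF AssA X P by blast
        then have "hom_zero R X (W P)" using \<open>\<forall>F\<in>free Z. hom_zero R X F\<close> by blast
        then show False using hom[OF X, of "W P"] W[of P] AssA X P by auto
      qed
      then show ?thesis using X by (auto simp: tors_def)
    qed
    have F: "X \<in> free Z" if X: "X \<in> \<X>" and "\<forall>T\<in>tors Z. hom_zero R T X" for X
    proof -
      have False if P: "P \<in> Ass R X" "P \<in> Z" for P
      proof -
        have "hom_zero R (W P) X" using WZ P \<open>\<forall>T\<in>tors Z. hom_zero R T X\<close> by blast
        then show False using hom[of "W P" X] W[of P] AssA X P by auto
      qed
      then show ?thesis using X by (auto simp: free_def)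
    qed
    have sub: "tors Z \<subseteq> \<X>" "free Z \<subseteq> \<X>" by (auto simp: tors_def free_def)
    have "subcategory R (tors Z)" "subcategory R (free Z)"
      unfolding tors_def free_def by (rule subcategory_Ass_restrict[OF assms(3)])+
    moreover have "tors Z = {X \<in> \<X>. \<forall>F\<in>free Z. hom_zero R X F}"
      using sub orth T by blast
    moreover have "free Z = {X \<in> \<X>. \<forall>T\<in>tors Z. hom_zero R T X}"
      using sub orth F by blast
    ultimately show "weak_torsion_pair R \<X> (tors Z) (free Z)"
      using sub unfolding weak_torsion_pair_def by (intro conjI)
  qed
  have recover: "specialization_closed (subtopology (zariski R) ?A) (Ass_sub R \<T>) \<and>
      tors (Ass_sub R \<T>) = \<T> \<and> free (Ass_sub R \<T>) = \<F>"
    if wtp: "weak_torsion_pair R \<X> \<T> \<F>" for \<T> \<F>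
  proof -
    have TX: "\<T> \<subseteq> \<X>" and FX: "\<F> \<subseteq> \<X>"
      and T: "\<And>X. X \<in> \<T> \<longleftrightarrow> X \<in> \<X> \<and> (\<forall>F\<in>\<F>. hom_zero R X F)"
      and F: "\<And>X. X \<in> \<F> \<longleftrightarrow> X \<in> \<X> \<and> (\<forall>T\<in>\<T>. hom_zero R T X)"
      using wtp unfolding weak_torsion_pair_def by blast+
    define Z where "Z = Ass_sub R \<T>"
    have ZA: "Z \<subseteq> ?A" using TX by (auto simp: Z_def Ass_sub_def)
    have up: "P \<in> Z" if Q: "Q \<in> Z" and P: "P \<in> ?A" and QP: "Q \<subseteq> P" for P Q
    proof -
      obtain X where X: "X \<in> \<T>" "Q \<in> Ass R X" using Q by (auto simp: Z_def Ass_sub_def)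
      \<comment> \<open>A nonzero map from \<open>W P\<close> to \<open>Y\<close> needs a prime above \<open>P\<close>, hence above \<open>Q\<close>, in \<open>Ass Y\<close>;
        then there would be a nonzero map from \<open>X\<close> to \<open>Y\<close> as well.\<close>
      have "hom_zero R (W P) Y" if Y: "Y \<in> \<F>" for Y
      proof -
        have "hom_zero R X Y" using X(1) Y T by blast
        then have "\<not> (\<exists>P'\<in>Ass R Y. Q \<subseteq> P')" using hom[of X Y] X Y TX FX by blast
        then show ?thesis using hom[of "W P" Y] W[OF P] QP Y FX by (fastforce dest: subsetD)
      qed
      then have "W P \<in> \<T>" using T W[OF P] by blast
      then show ?thesis using W[OF P] unfolding Z_def Ass_sub_def by blast
    qed
    \<comment> \<open>It is enough to recover \<open>\<F>\<close>: the torsion class of a pair is determined by its torsion-free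
      class, and \<open>(tors Z, free Z)\<close> is already known to be a pair.\<close>
    have "X \<in> \<F> \<longleftrightarrow> X \<in> free Z" for X
    proof
      assume X: "X \<in> \<F>"
      have False if P: "P \<in> Ass R X" "P \<in> Z" for P
      proof -
        obtain Y where Y: "Y \<in> \<T>" "P \<in> Ass R Y" using P by (auto simp: Z_def Ass_sub_def)
        then have "hom_zero R Y X" using T X by blast
        then show False using hom[of Y X] Y X TX FX P by blast
      qed
      then show "X \<in> free Z" using X FX by (auto simp: free_def)
    next
      assume X: "X \<in> free Z"
      then have XX: "X \<in> \<X>" by (simp add: free_def)
      have "hom_zero R Y X" if Y: "Y \<in> \<T>" for Y
      proof -
        have "Q \<in> Z" if "Q \<in> Ass R Y" for Q using that Y by (auto simp: Z_def Ass_sub_def)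
        then have "\<not> (\<exists>P\<in>Ass R X. \<exists>Q\<in>Ass R Y. Q \<subseteq> P)"
          using up AssA[OF XX] X by (fastforce simp: free_def)
        then show ?thesis using hom[of Y X] Y TX XX by blast
      qed
      then show "X \<in> \<F>" using F XX by blast
    qed
    then have free: "free Z = \<F>" by blast
    moreover have "tors Z = \<T>"
    proof -
      have "tors Z = {X \<in> \<X>. \<forall>F\<in>free Z. hom_zero R X F}"
        using pair[OF ZA] up unfolding weak_torsion_pair_def by metis
      then show ?thesis using T free by blast
    qed
    ultimately show ?thesis using ZA up unfolding closed_iff Z_def by blast
  qed
  have "bij_betw (\<lambda>(\<T>, \<F>). Ass_sub R \<T>) {(\<T>, \<F>). weak_torsion_pair R \<X> \<T> \<F>}
    {Z. specialization_closed (subtopology (zariski R) ?A) Z}"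
  proof (rule bij_betw_byWitness[where f' = "\<lambda>Z. (tors Z, free Z)"])
    show "\<forall>p\<in>{(\<T>, \<F>). weak_torsion_pair R \<X> \<T> \<F>}.
        (\<lambda>Z. (tors Z, free Z)) ((\<lambda>(\<T>, \<F>). Ass_sub R \<T>) p) = p"
      using recover by auto
    show "\<forall>Z\<in>{Z. specialization_closed (subtopology (zariski R) ?A) Z}.
        (\<lambda>(\<T>, \<F>). Ass_sub R \<T>) (tors Z, free Z) = Z"
      using Ass_tors by (auto simp: closed_iff)
    show "(\<lambda>(\<T>, \<F>). Ass_sub R \<T>) ` {(\<T>, \<F>). weak_torsion_pair R \<X> \<T> \<F>} \<subseteq>
        {Z. specialization_closed (subtopology (zariski R) ?A) Z}"
      using recover by auto
    show "(\<lambda>Z. (tors Z, free Z)) ` {Z. specialization_closed (subtopology (zariski R) ?A) Z} \<subseteq>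
        {(\<T>, \<F>). weak_torsion_pair R \<X> \<T> \<F>}"
      using pair by (auto simp: closed_iff)
  qed
  then show ?thesis by blast
qed

end
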